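(* Let $x_1,\dots,x_n\in\mathbb{R}^p$ be data points, let $\varepsilon>0$ be large enough that all points in the graph are connected, and let $M=D^{-1}L$ be the Markov matrix of the Gaussian-kernel random walk on these points, with eigenvalues $1=\lambda_0>\lambda_1\ge\dots\ge\lambda_{n-1}\ge 0$, left eigenvectors $\phi_j$ and right eigenvectors $\psi_j$ ($0\le j\le n-1$) normalized as in the context. Let $t\ge0$ be an integer (number of time steps), let $p(t,y|x)$ be the $t$-step transition probability from $x$ to $y$, and let $1\le k\le n-1$. Out of all $k$-dimensional approximations of the form $$\hat p(t,y|x)=\phi_0(y)+\sum_{j=1}^k a_j(x,t)\,w_j(y)$$ for the probability distribution at time $t$ (where $a_j(\cdot,t)$ and $w_j$ are real-valued functions on the set of data points), the one that minimizes the mean squared error $$\mathbb{E}_x\bigl\{\|p(t,\cdot|x)-\hat p(t,\cdot|x)\|_w^2\bigr\}=\sum_x\phi_0(x)\sum_y\bigl(p(t,y|x)-\hat p(t,y|x)\bigr)^2\frac1{\phi_0(y)},$$ in which averaging over initial points $x$ is with respect to the stationary density $\phi_0(x)$, is given by $w_j(y)=\phi_j(y)$ and $a_j(x,t)=\lambda_j^t\psi_j(x)$. Therefore, the optimal $k$-dimensional approximation is given by the truncated sum $$\hat p(t,y|x)=\phi_0(y)+\sum_{j=1}^k\lambda_j^t\psi_j(x)\phi_j(y).$$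
   Context: $L$ is the $n\times n$ matrix $L_{i,j}=\exp\bigl(-\|x_i-x_j\|^2/(2\varepsilon)\bigr)$, $D$ is the diagonal matrix with $D_{i,i}=\sum_j L_{i,j}$, and $M=D^{-1}L$. $M$ is a row-stochastic matrix and $M_{i,j}$ is the probability that the random walk jumps from $x_i$ to $x_j$ in one time step. Functions on the data points are identified with vectors in $\mathbb{R}^n$, i.e. $f(x_i)=f_i$, and sums over $x$ and $y$ run over the data points (indices $1,\dots,n$). The $t$-step transition probability is $p(t,x_j|x_i)=(M^t)_{i,j}$. The weighted norm is $\|f\|_w^2=\sum_y f(y)^2w(y)$ with weight $w(y)=1/\phi_0(y)$ (the weight $w$ is not to be confused with the functions $w_j$). The matrix $M_s=D^{1/2}MD^{-1/2}$ is symmetric and has the same eigenvalues as $M$, namely $1=\lambda_0>\lambda_1\ge\dots\ge\lambda_{n-1}\ge0$. Let $v_0,\dots,v_{n-1}$ be an orthonormal basis of $\mathbb{R}^n$ (standard dot product) with $M_sv_j=\lambda_jv_j$, where the sign of $v_0$ is chosen so that its entries are positive. Put $S=\sum_jD_{j,j}$. The left eigenvectors $\phi_j$ and right eigenvectors $\psi_j$ of $M$ are $$\phi_j=S^{-1/2}D^{1/2}v_j,\qquad \psi_j=S^{1/2}D^{-1/2}v_j ,$$ so that $\langle\phi_i,\psi_j\rangle=\delta_{i,j}$, $\phi_0(x_i)=D_{i,i}/S$ (the stationary distribution) and $\psi_0\equiv1$. The convention $0^0=1$ is used for $\lambda_j^t$ when $t=0$. *)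

theory Defs
  imports "HOL-Analysis.Analysis"
begin

(* The data points are a family indexed by a finite type 'n, so n = CARD('n), and functions on
   the data points are vectors in real^'n.  Eigenvalues and eigenvectors are numbered
   0, ..., CARD('n) - 1 by natural numbers. *)

definition diag :: "('n::finite \<Rightarrow> real) \<Rightarrow> real^'n^'n" where
  "diag d = (\<chi> i j. if i = j then d i else 0)"

(* The operation ^ on real^'n^'n is the power for the entrywise product, so it cannot be used. *)
definition mat_power :: "real^'n^'n \<Rightarrow> nat \<Rightarrow> real^('n::finite)^'n" where
  "mat_power A t = ((\<lambda>B. A ** B) ^^ t) (mat 1)"

definition kernel_mat :: "('n::finite \<Rightarrow> real^'p::finite) \<Rightarrow> real \<Rightarrow> real^'n^'n" where
  "kernel_mat x \<epsilon> = (\<chi> i j. exp (- (norm (x i - x j))\<^sup>2 / (2 * \<epsilon>)))"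

(* Holds for every \<epsilon> > 0, since the Gaussian kernel is positive. *)
definition graph_connected :: "('n::finite \<Rightarrow> real^'p::finite) \<Rightarrow> real \<Rightarrow> bool" where
  "graph_connected x \<epsilon> \<longleftrightarrow> (\<forall>i j. (i, j) \<in> {(a, b). kernel_mat x \<epsilon> $ a $ b > 0}\<^sup>*)"

definition node_degree :: "('n::finite \<Rightarrow> real^'p::finite) \<Rightarrow> real \<Rightarrow> 'n \<Rightarrow> real" where
  "node_degree x \<epsilon> i = (\<Sum>j\<in>UNIV. kernel_mat x \<epsilon> $ i $ j)"

definition degree_mat :: "('n::finite \<Rightarrow> real^'p::finite) \<Rightarrow> real \<Rightarrow> real^'n^'n" where
  "degree_mat x \<epsilon> = diag (node_degree x \<epsilon>)"

definition sqrt_degree_mat :: "('n::finite \<Rightarrow> real^'p::finite) \<Rightarrow> real \<Rightarrow> real^'n^'n" where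
  "sqrt_degree_mat x \<epsilon> = diag (\<lambda>i. sqrt (node_degree x \<epsilon> i))"

definition markov_mat :: "('n::finite \<Rightarrow> real^'p::finite) \<Rightarrow> real \<Rightarrow> real^'n^'n" where
  "markov_mat x \<epsilon> = matrix_inv (degree_mat x \<epsilon>) ** kernel_mat x \<epsilon>"

definition sym_markov_mat :: "('n::finite \<Rightarrow> real^'p::finite) \<Rightarrow> real \<Rightarrow> real^'n^'n" where
  "sym_markov_mat x \<epsilon> =
     sqrt_degree_mat x \<epsilon> ** markov_mat x \<epsilon> ** matrix_inv (sqrt_degree_mat x \<epsilon>)"

(* transition_prob x \<epsilon> t i $ j is p(t, x_j | x_i). *)
definition transition_prob ::
  "('n::finite \<Rightarrow> real^'p::finite) \<Rightarrow> real \<Rightarrow> nat \<Rightarrow> 'n \<Rightarrow> real^'n" where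
  "transition_prob x \<epsilon> t i = mat_power (markov_mat x \<epsilon>) t $ i"

definition is_orthonormal_basis :: "(nat \<Rightarrow> real^'n::finite) \<Rightarrow> bool" where
  "is_orthonormal_basis v \<longleftrightarrow>
     (\<forall>i<CARD('n). \<forall>j<CARD('n). v i \<bullet> v j = (if i = j then 1 else 0)) \<and>
     span (v ` {..<CARD('n)}) = UNIV"

(* That lam 0 = 1, lam 1 < 1 and lam j \<ge> 0 are properties of the Gaussian random walk and
   are not part of the definition. *)
definition markov_spectrum ::
  "('n::finite \<Rightarrow> real^'p::finite) \<Rightarrow> real \<Rightarrow> (nat \<Rightarrow> real) \<Rightarrow> (nat \<Rightarrow> real^'n) \<Rightarrow> bool" where
  "markov_spectrum x \<epsilon> lam v \<longleftrightarrow>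
     is_orthonormal_basis v \<and>
     (\<forall>j<CARD('n). sym_markov_mat x \<epsilon> *v v j = lam j *\<^sub>R v j) \<and>
     (\<forall>i j. i \<le> j \<longrightarrow> j < CARD('n) \<longrightarrow> lam j \<le> lam i) \<and>
     (\<forall>i. v 0 $ i > 0)"

definition total_degree :: "('n::finite \<Rightarrow> real^'p::finite) \<Rightarrow> real \<Rightarrow> real" where
  "total_degree x \<epsilon> = (\<Sum>i\<in>UNIV. node_degree x \<epsilon> i)"

definition left_eigvec ::
  "('n::finite \<Rightarrow> real^'p::finite) \<Rightarrow> real \<Rightarrow> (nat \<Rightarrow> real^'n) \<Rightarrow> nat \<Rightarrow> real^'n" where
  "left_eigvec x \<epsilon> v j = (1 / sqrt (total_degree x \<epsilon>)) *\<^sub>R (sqrt_degree_mat x \<epsilon> *v v j)"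

definition right_eigvec ::
  "('n::finite \<Rightarrow> real^'p::finite) \<Rightarrow> real \<Rightarrow> (nat \<Rightarrow> real^'n) \<Rightarrow> nat \<Rightarrow> real^'n" where
  "right_eigvec x \<epsilon> v j =
     sqrt (total_degree x \<epsilon>) *\<^sub>R (matrix_inv (sqrt_degree_mat x \<epsilon>) *v v j)"

definition weighted_norm_sq :: "real^'n \<Rightarrow> real^'n::finite \<Rightarrow> real" where
  "weighted_norm_sq w f = (\<Sum>y\<in>UNIV. (f $ y)\<^sup>2 * w $ y)"

definition mean_sq_error ::
  "real^'n \<Rightarrow> ('n \<Rightarrow> real^'n) \<Rightarrow> ('n \<Rightarrow> real^'n::finite) \<Rightarrow> real" where
  "mean_sq_error \<phi>0 p q =
     (\<Sum>i\<in>UNIV. \<phi>0 $ i * weighted_norm_sq (\<chi> y. 1 / \<phi>0 $ y) (p i - q i))"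

(* kdim_approx \<phi>0 k t a w i $ y is phi_0(y) + sum_{j=1}^k a_j(x_i, t) w_j(y). *)
definition kdim_approx ::
  "real^'n \<Rightarrow> nat \<Rightarrow> nat \<Rightarrow> (nat \<Rightarrow> 'n \<Rightarrow> nat \<Rightarrow> real) \<Rightarrow> (nat \<Rightarrow> real^'n) \<Rightarrow> 'n \<Rightarrow> real^'n::finite"
  where
  "kdim_approx \<phi>0 k t a w i = \<phi>0 + (\<Sum>j = 1..k. a j i t *\<^sub>R w j)"

end

theory Submission
  imports Defs
begin

text \<open>After weighting the entry \<open>(x\<^sub>i, y)\<close> by \<open>sqrt (\<phi>\<^sub>0(x\<^sub>i) / \<phi>\<^sub>0(y))\<close>, the mean squared error becomes
  the squared Frobenius distance from \<open>M\<^sub>s\<^sup>t - v\<^sub>0 v\<^sub>0\<^sup>T = \<Sum>\<^sub>j\<^sub>\<ge>\<^sub>1 \<lambda>\<^sub>j\<^sup>t v\<^sub>j v\<^sub>j\<^sup>T\<close> to a matrix of rank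
  at most \<open>k\<close>, so the claim is the Eckart--Young theorem. The values \<open>\<lambda>\<^sub>j\<^sup>t\<close> are in decreasing order
  of modulus because the Gaussian kernel is positive semidefinite.\<close>

section \<open>Orthonormal families: Pythagoras and Bessel\<close>

text \<open>Expand the inner product and complete the square in each coefficient. Since
  \<open>c\<close> is arbitrary, one identity yields the norm of a combination (\<open>x\<close>
  zero), Bessel's inequality (\<open>c\<close> the Fourier coefficients) and a lower bound for the
  distance to a subspace.\<close>

lemma norm_diff_orthonormal:
  fixes u :: "'j \<Rightarrow> 'a::real_inner"
  assumes "finite J"
    and on: "\<And>i j. i \<in> J \<Longrightarrow> j \<in> J \<Longrightarrow> u i \<bullet> u j = (if i = j then 1 else 0)"
  shows "(norm (x - (\<Sum>j\<in>J. c j *\<^sub>R u j)))\<^sup>2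
    = (norm x)\<^sup>2 - (\<Sum>j\<in>J. (x \<bullet> u j)\<^sup>2) + (\<Sum>j\<in>J. (c j - x \<bullet> u j)\<^sup>2)"
proof -
  let ?s = "\<Sum>j\<in>J. c j *\<^sub>R u j"
  have us: "u i \<bullet> ?s = c i" if "i \<in> J" for i
  proof -
    have "u i \<bullet> ?s = (\<Sum>j\<in>J. if i = j then c j else 0)"
      unfolding inner_sum_right using that by (intro sum.cong) (auto simp: on)
    then show ?thesis using that assms(1) by simp
  qed
  have ss: "?s \<bullet> ?s = (\<Sum>j\<in>J. (c j)\<^sup>2)"
    by (simp add: inner_sum_left us power2_eq_square)
  have xs: "x \<bullet> ?s = (\<Sum>j\<in>J. c j * (x \<bullet> u j))"
    by (simp add: inner_sum_right)
  have "(norm (x - ?s))\<^sup>2 = x \<bullet> x - 2 * (x \<bullet> ?s) + ?s \<bullet> ?s"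
    by (simp add: power2_norm_eq_inner inner_diff_left inner_diff_right inner_commute)
  also have "\<dots> = (norm x)\<^sup>2 - (\<Sum>j\<in>J. (x \<bullet> u j)\<^sup>2) + (\<Sum>j\<in>J. (c j - x \<bullet> u j)\<^sup>2)"
    unfolding ss xs
    by (simp add: power2_norm_eq_inner power2_diff sum.distrib sum_subtractf sum_distrib_left
        mult.assoc)
  finally show ?thesis .
qed

lemma norm_sum_orthonormal:
  fixes u :: "'j \<Rightarrow> 'a::real_inner"
  assumes "finite J"
    and "\<And>i j. i \<in> J \<Longrightarrow> j \<in> J \<Longrightarrow> u i \<bullet> u j = (if i = j then 1 else 0)"
  shows "(norm (\<Sum>j\<in>J. c j *\<^sub>R u j))\<^sup>2 = (\<Sum>j\<in>J. (c j)\<^sup>2)"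
  using norm_diff_orthonormal[OF assms, of 0 c] by simp

lemma bessel_inequality:
  fixes u :: "'j \<Rightarrow> 'a::real_inner"
  assumes "finite J"
    and "\<And>i j. i \<in> J \<Longrightarrow> j \<in> J \<Longrightarrow> u i \<bullet> u j = (if i = j then 1 else 0)"
  shows "(\<Sum>j\<in>J. (x \<bullet> u j)\<^sup>2) \<le> (norm x)\<^sup>2"
proof -
  have "0 \<le> (norm (x - (\<Sum>j\<in>J. (x \<bullet> u j) *\<^sub>R u j)))\<^sup>2" by simp
  also have "\<dots> = (norm x)\<^sup>2 - (\<Sum>j\<in>J. (x \<bullet> u j)\<^sup>2)"
    by (subst norm_diff_orthonormal[OF assms]) auto
  finally show ?thesis by simp
qed

section \<open>The Eckart-Young theorem in the Frobenius norm\<close>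

text \<open>Bathtub principle: a total mass of at most \<open>k\<close>, with at most 1 per index,
  does best on the \<open>k\<close> largest values. Subtracting the threshold \<open>s k\<close>
  makes the values nonnegative up to \<open>k\<close> and nonpositive beyond it; the subtracted part
  is bounded through the total mass, which uses \<open>0 \<le> s k\<close>.\<close>

lemma sum_decreasing_weights_le:
  fixes s c :: "nat \<Rightarrow> real"
  assumes "1 \<le> k" "k \<le> N"
    and dec: "\<And>j l. 1 \<le> j \<Longrightarrow> j \<le> l \<Longrightarrow> l \<le> N \<Longrightarrow> s l \<le> s j"
    and "0 \<le> s k"
    and c0: "\<And>j. 0 \<le> c j" and c1: "\<And>j. j \<in> {1..N} \<Longrightarrow> c j \<le> 1"
    and ck: "(\<Sum>j=1..N. c j) \<le> real k"
  shows "(\<Sum>j=1..N. s j * c j) \<le> (\<Sum>j=1..k. s j)"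
proof -
  have eq: "{1..N} = {1..k} \<union> {k+1..N}" using assms(1,2) by auto
  have split: "(\<Sum>j=1..N. f j) = (\<Sum>j=1..k. f j) + (\<Sum>j=k+1..N. f j)" for f :: "nat \<Rightarrow> real"
    unfolding eq by (rule sum.union_disjoint) auto
  have "(\<Sum>j=1..k. (s j - s k) * c j) \<le> (\<Sum>j=1..k. s j - s k)"
    using c1 dec assms(1,2) by (intro sum_mono) (simp add: mult_left_le)
  moreover have "(\<Sum>j=k+1..N. (s j - s k) * c j) \<le> 0"
    using c0 dec assms(1,2) by (intro sum_nonpos mult_nonpos_nonneg) auto
  moreover have "s k * (\<Sum>j=1..N. c j) \<le> s k * real k"
    using ck \<open>0 \<le> s k\<close> by (rule mult_left_mono)
  moreover have "(\<Sum>j=1..N. s j * c j) = (\<Sum>j=1..N. (s j - s k) * c j) + s k * (\<Sum>j=1..N. c j)"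
    by (simp add: sum_distrib_left sum.distrib[symmetric] algebra_simps)
  moreover have "(\<Sum>j=1..k. s j - s k) = (\<Sum>j=1..k. s j) - s k * real k"
    by (simp add: sum_subtractf)
  ultimately show ?thesis
    using split[of "\<lambda>j. (s j - s k) * c j"] by linarith
qed

text \<open>The vectors inside the norm are the rows of the sum of \<open>\<sigma> j\<close> times
  the outer product of \<open>u j\<close> and \<open>v j\<close>. Pythagoras applies in each row;
  summing over rows then turns each \<open>u j\<close> into its unit norm.\<close>

lemma frobenius_norm_orthonormal_sum:
  fixes u :: "nat \<Rightarrow> real^'m::finite" and v :: "nat \<Rightarrow> 'a::real_inner"
  assumes "finite J"
    and onu: "\<And>j. j \<in> J \<Longrightarrow> norm (u j) = 1"
    and onv: "\<And>i j. i \<in> J \<Longrightarrow> j \<in> J \<Longrightarrow> v i \<bullet> v j = (if i = j then 1 else 0)"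
  shows "(\<Sum>i\<in>UNIV. (norm (\<Sum>j\<in>J. (\<sigma> j * u j $ i) *\<^sub>R v j))\<^sup>2) = (\<Sum>j\<in>J. (\<sigma> j)\<^sup>2)"
proof -
  have "(norm (\<Sum>j\<in>J. (\<sigma> j * u j $ i) *\<^sub>R v j))\<^sup>2 = (\<Sum>j\<in>J. (\<sigma> j * u j $ i)\<^sup>2)" for i
    by (rule norm_sum_orthonormal[OF assms(1) onv])
  then have "(\<Sum>i\<in>UNIV. (norm (\<Sum>j\<in>J. (\<sigma> j * u j $ i) *\<^sub>R v j))\<^sup>2)
      = (\<Sum>j\<in>J. \<Sum>i\<in>UNIV. (\<sigma> j * u j $ i)\<^sup>2)"
    by (simp only:) (rule sum.swap)
  also have "\<dots> = (\<Sum>j\<in>J. (\<sigma> j)\<^sup>2 * (u j \<bullet> u j))"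
    by (simp add: inner_vec_def sum_distrib_left power2_eq_square mult_ac)
  also have "\<dots> = (\<Sum>j\<in>J. (\<sigma> j)\<^sup>2)"
    using onu by (intro sum.cong) (auto simp: norm_eq_1)
  finally show ?thesis .
qed

text \<open>Rank at most \<open>k\<close> is expressed by letting all rows \<open>c i\<close> lie in
  a subspace \<open>W\<close> of dimension at most \<open>k\<close>. The error is at least the total
  energy minus the energy of the rows projected onto \<open>W\<close>, and the bathtub principle
  bounds the latter.\<close>

theorem eckart_young_frobenius:
  fixes u :: "nat \<Rightarrow> real^'m::finite" and v :: "nat \<Rightarrow> 'a::euclidean_space"
    and \<sigma> :: "nat \<Rightarrow> real"
  assumes onu: "\<And>i j. i \<in> {1..N} \<Longrightarrow> j \<in> {1..N} \<Longrightarrow> u i \<bullet> u j = (if i = j then 1 else 0)"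
    and onv: "\<And>i j. i \<in> {1..N} \<Longrightarrow> j \<in> {1..N} \<Longrightarrow> v i \<bullet> v j = (if i = j then 1 else 0)"
    and dec: "\<And>j l. 1 \<le> j \<Longrightarrow> j \<le> l \<Longrightarrow> l \<le> N \<Longrightarrow> (\<sigma> l)\<^sup>2 \<le> (\<sigma> j)\<^sup>2"
    and k: "1 \<le> k" "k \<le> N"
    and W: "subspace W" "dim W \<le> k" "\<And>i. c i \<in> W"
  shows "(\<Sum>j=k+1..N. (\<sigma> j)\<^sup>2)
    \<le> (\<Sum>i\<in>UNIV. (norm ((\<Sum>j=1..N. (\<sigma> j * u j $ i) *\<^sub>R v j) - c i))\<^sup>2)"
proof -
  define b where "b = (\<lambda>i. \<Sum>j=1..N. (\<sigma> j * u j $ i) *\<^sub>R v j)"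
  obtain B where B: "pairwise orthogonal B" "\<And>x. x \<in> B \<Longrightarrow> norm x = 1" "independent B"
    "card B = dim W" "span B = W"
    using orthonormal_basis_subspace[OF W(1)] by metis
  have finB: "finite B" using B(3) independent_imp_finite by blast
  have onB: "x \<bullet> y = (if x = y then 1 else 0)" if "x \<in> B" "y \<in> B" for x y
    using B(1) B(2)[OF that(1)] that by (auto simp: pairwise_def orthogonal_def norm_eq_1)
  have energy: "(\<Sum>i\<in>UNIV. (b i \<bullet> x)\<^sup>2) = (\<Sum>j=1..N. (\<sigma> j)\<^sup>2 * (v j \<bullet> x)\<^sup>2)" for x
  proof -
    \<comment> \<open>Read over all \<open>i\<close>, this is the matrix with rows
      \<open>b i\<close> applied to \<open>x\<close>, so orthonormality of \<open>u\<close> gives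
      its squared length.\<close>
    have "b i \<bullet> x = (\<Sum>j=1..N. (\<sigma> j * (v j \<bullet> x)) *\<^sub>R u j) $ i" for i
      by (simp add: b_def inner_sum_left mult_ac)
    then have "(\<Sum>i\<in>UNIV. (b i \<bullet> x)\<^sup>2) = (norm (\<Sum>j=1..N. (\<sigma> j * (v j \<bullet> x)) *\<^sub>R u j))\<^sup>2"
      by (simp only: power2_norm_eq_inner inner_vec_def) (simp add: power2_eq_square)
    also have "\<dots> = (\<Sum>j=1..N. (\<sigma> j * (v j \<bullet> x))\<^sup>2)"
      by (rule norm_sum_orthonormal[OF _ onu]) auto
    finally show ?thesis by (simp add: power_mult_distrib)
  qed
  have total: "(\<Sum>i\<in>UNIV. (norm (b i))\<^sup>2) = (\<Sum>j=1..N. (\<sigma> j)\<^sup>2)"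
    unfolding b_def using onu onv
    by (intro frobenius_norm_orthonormal_sum) (auto simp: norm_eq_1)
  \<comment> \<open>No point of \<open>W\<close> is closer to \<open>b i\<close> than its orthogonal
    projection.\<close>
  have row: "(norm (b i))\<^sup>2 - (\<Sum>x\<in>B. (b i \<bullet> x)\<^sup>2) \<le> (norm (b i - c i))\<^sup>2" for i
  proof -
    have "c i \<in> span B" using W(3) B(5) by simp
    then obtain e where e: "c i = (\<Sum>x\<in>B. e x *\<^sub>R x)"
      using finB by (auto simp: span_finite)
    show ?thesis unfolding e
      by (subst norm_diff_orthonormal[OF finB onB]) (auto intro: sum_nonneg)
  qed
  \<comment> \<open>The weight of \<open>(\<sigma> j)^2\<close> is the squared length of the
    projection of \<open>v j\<close> onto \<open>W\<close>.\<close>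
  have "(\<Sum>j=1..N. (\<sigma> j)\<^sup>2 * (\<Sum>x\<in>B. (v j \<bullet> x)\<^sup>2)) \<le> (\<Sum>j=1..k. (\<sigma> j)\<^sup>2)"
  proof -
    have "(\<Sum>x\<in>B. (v j \<bullet> x)\<^sup>2) \<le> 1" if "j \<in> {1..N}" for j
      using bessel_inequality[OF finB onB, of "v j"] onv[OF that that]
      by (simp add: power2_norm_eq_inner)
    moreover have "(\<Sum>j=1..N. \<Sum>x\<in>B. (v j \<bullet> x)\<^sup>2) \<le> real k"
    proof -
      \<comment> \<open>The roles are exchanged: Bessel is now applied to each \<open>x\<close> in
        \<open>B\<close> against the family \<open>v\<close>, so the total mass is at most
        \<open>card B\<close>, the dimension of \<open>W\<close>.\<close>
      have "(\<Sum>j=1..N. \<Sum>x\<in>B. (v j \<bullet> x)\<^sup>2) = (\<Sum>x\<in>B. \<Sum>j=1..N. (x \<bullet> v j)\<^sup>2)"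
        by (simp add: sum.swap[of _ B] inner_commute)
      also have "\<dots> \<le> (\<Sum>x\<in>B. 1)"
      proof (rule sum_mono)
        fix x assume "x \<in> B"
        then show "(\<Sum>j=1..N. (x \<bullet> v j)\<^sup>2) \<le> 1"
          using bessel_inequality[of "{1..N}" v x] onv B(2) by simp
      qed
      finally show ?thesis using B(4) W(2) by simp
    qed
    ultimately show ?thesis
      using k dec by (intro sum_decreasing_weights_le) (auto intro: sum_nonneg)
  qed
  also have "(\<Sum>j=1..N. (\<sigma> j)\<^sup>2 * (\<Sum>x\<in>B. (v j \<bullet> x)\<^sup>2)) = (\<Sum>i\<in>UNIV. \<Sum>x\<in>B. (b i \<bullet> x)\<^sup>2)"
    by (subst sum.swap[of _ B UNIV]) (simp add: energy sum_distrib_left sum.swap[of _ B])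
  finally have captured: "(\<Sum>i\<in>UNIV. \<Sum>x\<in>B. (b i \<bullet> x)\<^sup>2) \<le> (\<Sum>j=1..k. (\<sigma> j)\<^sup>2)" .
  have "{1..N} = {1..k} \<union> {k+1..N}" using k by auto
  then have "(\<Sum>j=1..N. (\<sigma> j)\<^sup>2) = (\<Sum>j=1..k. (\<sigma> j)\<^sup>2) + (\<Sum>j=k+1..N. (\<sigma> j)\<^sup>2)"
    by (simp add: sum.union_disjoint)
  then have "(\<Sum>j=k+1..N. (\<sigma> j)\<^sup>2)
      \<le> (\<Sum>i\<in>UNIV. (norm (b i))\<^sup>2 - (\<Sum>x\<in>B. (b i \<bullet> x)\<^sup>2))"
    using captured total by (simp add: sum_subtractf)
  also have "\<dots> \<le> (\<Sum>i\<in>UNIV. (norm (b i - c i))\<^sup>2)" by (intro sum_mono row)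
  finally show ?thesis unfolding b_def .
qed

section \<open>Positive semidefiniteness of the Gaussian kernel\<close>

text \<open>Expanding the power coordinatewise is the Schur product theorem for Gram matrices.\<close>
lemma gram_power_psd:
  fixes x :: "'n::finite \<Rightarrow> 'a::euclidean_space"
  shows "0 \<le> (\<Sum>i\<in>UNIV. \<Sum>j\<in>UNIV. c i * c j * (x i \<bullet> x j) ^ m)"
proof (induction m arbitrary: c)
  case 0
  have "(\<Sum>i\<in>UNIV. \<Sum>j\<in>UNIV. c i * c j) = (\<Sum>i\<in>UNIV. c i)\<^sup>2"
    by (simp add: power2_eq_square sum_product)
  then show ?case by simp
next
  case (Suc m)
  have "(\<Sum>i\<in>UNIV. \<Sum>j\<in>UNIV. c i * c j * (x i \<bullet> x j) ^ Suc m)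
      = (\<Sum>i\<in>UNIV. \<Sum>j\<in>UNIV. \<Sum>e\<in>Basis. (c i * (x i \<bullet> e)) * (c j * (x j \<bullet> e)) * (x i \<bullet> x j) ^ m)"
  proof (intro sum.cong refl)
    fix i j
    have "c i * c j * (x i \<bullet> x j) ^ Suc m
        = c i * c j * (x i \<bullet> x j) ^ m * (\<Sum>e\<in>Basis. (x i \<bullet> e) * (x j \<bullet> e))"
      by (simp add: euclidean_inner[of "x i" "x j", symmetric] mult_ac)
    then show "c i * c j * (x i \<bullet> x j) ^ Suc m
        = (\<Sum>e\<in>Basis. (c i * (x i \<bullet> e)) * (c j * (x j \<bullet> e)) * (x i \<bullet> x j) ^ m)"
      by (simp add: sum_distrib_left mult_ac)
  qed
  also have "\<dots> = (\<Sum>e\<in>Basis. \<Sum>i\<in>UNIV. \<Sum>j\<in>UNIV.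
      (c i * (x i \<bullet> e)) * (c j * (x j \<bullet> e)) * (x i \<bullet> x j) ^ m)"
    by (simp only: sum.swap[of _ Basis UNIV])
  also have "\<dots> \<ge> 0" by (rule sum_nonneg) (rule Suc.IH)
  finally show ?case .
qed

text \<open>Each term of the exponential series is a nonnegative multiple of a power of the Gram
  form, and nonnegativity passes to the sum of the series.\<close>

lemma exp_gram_psd:
  fixes x :: "'n::finite \<Rightarrow> 'a::euclidean_space"
  assumes "r \<ge> 0"
  shows "0 \<le> (\<Sum>i\<in>UNIV. \<Sum>j\<in>UNIV. c i * c j * exp (r * (x i \<bullet> x j)))"
proof -
  have "(\<lambda>m. \<Sum>i\<in>UNIV. \<Sum>j\<in>UNIV. c i * c j * ((r * (x i \<bullet> x j)) ^ m /\<^sub>R fact m))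
      sums (\<Sum>i\<in>UNIV. \<Sum>j\<in>UNIV. c i * c j * exp (r * (x i \<bullet> x j)))"
    by (intro sums_sum sums_mult exp_converges)
  moreover have "0 \<le> (\<Sum>i\<in>UNIV. \<Sum>j\<in>UNIV. c i * c j * ((r * (x i \<bullet> x j)) ^ m /\<^sub>R fact m))" for m
  proof -
    have "(\<Sum>i\<in>UNIV. \<Sum>j\<in>UNIV. c i * c j * ((r * (x i \<bullet> x j)) ^ m /\<^sub>R fact m))
        = (r ^ m / fact m) * (\<Sum>i\<in>UNIV. \<Sum>j\<in>UNIV. c i * c j * (x i \<bullet> x j) ^ m)"
      by (simp add: sum_distrib_left power_mult_distrib field_simps)
    then show ?thesis using assms gram_power_psd[of c x m] by simp
  qed
  ultimately show ?thesis
    by (metis (no_types, lifting) sums_le sums_zero)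
qed

text \<open>Expanding the squared distance splits the Gaussian into a factor in \<open>x i\<close>,
  a factor in \<open>x j\<close> and the exponential of a scaled inner product. The first two are
  absorbed into the coefficients as \<open>d\<close>.\<close>

lemma kernel_mat_psd:
  fixes x :: "'n::finite \<Rightarrow> real^'p::finite"
  assumes "\<epsilon> > 0"
  shows "0 \<le> (\<Sum>i\<in>UNIV. \<Sum>j\<in>UNIV. c i * c j * kernel_mat x \<epsilon> $ i $ j)"
proof -
  define d where "d i = c i * exp (- (x i \<bullet> x i) / (2 * \<epsilon>))" for i
  have "c i * c j * kernel_mat x \<epsilon> $ i $ j = d i * d j * exp ((1 / \<epsilon>) * (x i \<bullet> x j))" for i j
  proof -
    have "- (norm (x i - x j))\<^sup>2 / (2 * \<epsilon>)
        = - (x i \<bullet> x i) / (2 * \<epsilon>) + - (x j \<bullet> x j) / (2 * \<epsilon>) + (1 / \<epsilon>) * (x i \<bullet> x j)"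
      using assms by (simp add: power2_norm_eq_inner inner_diff_left inner_diff_right
          inner_commute field_simps)
    then have "kernel_mat x \<epsilon> $ i $ j = exp (- (x i \<bullet> x i) / (2 * \<epsilon>)) *
        exp (- (x j \<bullet> x j) / (2 * \<epsilon>)) * exp ((1 / \<epsilon>) * (x i \<bullet> x j))"
      unfolding kernel_mat_def by (simp only: vec_lambda_beta exp_add)
    then show ?thesis by (simp add: d_def)
  qed
  then show ?thesis using exp_gram_psd[of "1 / \<epsilon>" d x] assms by simp
qed

section \<open>Entries of the random walk matrices and of their powers\<close>

text \<open>\<open>matrix_inv\<close> is a choice among two-sided inverses. Exhibiting one shows
  that the chosen matrix is an inverse, and uniqueness of inverses identifies the two.\<close>

lemma matrix_inv_diag:
  assumes "\<And>i. d i \<noteq> 0"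
  shows "matrix_inv (diag d) = diag (\<lambda>i. 1 / d i)"
proof -
  have *: "diag f ** diag g = diag (\<lambda>i. f i * g i)" for f g :: "'a::finite \<Rightarrow> real"
    by (simp add: diag_def matrix_matrix_mult_def vec_eq_iff if_distrib cong: if_cong)
      (auto intro!: sum.neutral)
  let ?P = "\<lambda>A'. diag d ** A' = mat 1 \<and> A' ** diag d = mat 1"
  have 1: "diag d ** diag (\<lambda>i. 1 / d i) = mat 1" "diag (\<lambda>i. 1 / d i) ** diag d = mat 1"
    unfolding * using assms by (simp_all add: diag_def mat_def)
  then have "matrix_inv (diag d) = matrix_inv (diag d) ** (diag d ** diag (\<lambda>i. 1 / d i))"
    by simp
  also have "\<dots> = diag (\<lambda>i. 1 / d i)"
    using someI[of ?P, OF conjI[OF 1]] by (simp add: matrix_mul_assoc matrix_inv_def)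
  finally show ?thesis .
qed

lemma diag_mult_nth: "(diag d ** A) $ i $ j = d i * A $ i $ j"
  by (simp add: diag_def matrix_matrix_mult_def if_distrib[of "\<lambda>a. a * _"] cong: if_cong)

lemma mult_diag_nth: "(A ** diag d) $ i $ j = A $ i $ j * d j"
  by (simp add: diag_def matrix_matrix_mult_def if_distrib[of "\<lambda>a. _ * a"] cong: if_cong)

lemma diag_mult_vec_nth: "(diag d *v f) $ i = d i * f $ i"
  by (simp add: diag_def matrix_vector_mult_def if_distrib[of "\<lambda>a. a * _"] cong: if_cong)

lemma kernel_mat_pos: "kernel_mat x \<epsilon> $ i $ j > 0"
  by (simp add: kernel_mat_def)

lemma node_degree_pos: "node_degree x \<epsilon> i > 0"
  unfolding node_degree_def by (intro sum_pos) (auto simp: kernel_mat_pos)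

lemma total_degree_pos: "total_degree x \<epsilon> > 0"
  unfolding total_degree_def by (intro sum_pos) (auto simp: node_degree_pos)

lemma node_degree_neq_0: "node_degree x \<epsilon> i \<noteq> 0"
  using node_degree_pos[of x \<epsilon> i] by simp

lemma markov_mat_nth: "markov_mat x \<epsilon> $ i $ j = kernel_mat x \<epsilon> $ i $ j / node_degree x \<epsilon> i"
  unfolding markov_mat_def degree_mat_def
  by (simp add: matrix_inv_diag node_degree_neq_0 diag_mult_nth)

lemma sym_markov_mat_nth:
  "sym_markov_mat x \<epsilon> $ i $ j
    = kernel_mat x \<epsilon> $ i $ j / (sqrt (node_degree x \<epsilon> i) * sqrt (node_degree x \<epsilon> j))"
proof -
  have "sqrt (node_degree x \<epsilon> i) * (a / node_degree x \<epsilon> i) * (1 / b)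
      = a / (sqrt (node_degree x \<epsilon> i) * b)" for a b
    using real_sqrt_mult_self[of "node_degree x \<epsilon> i"] node_degree_pos[of x \<epsilon> i]
    by (simp add: divide_simps)
  then show ?thesis
    unfolding sym_markov_mat_def sqrt_degree_mat_def
    by (simp only: matrix_inv_diag node_degree_neq_0 diag_mult_nth mult_diag_nth markov_mat_nth
        real_sqrt_eq_zero_cancel_iff not_False_eq_True)
qed

text \<open>\<open>markov_mat\<close> and \<open>sym_markov_mat\<close> are similar through the
  square root of the degree matrix; in a power the inner degree factors cancel and only those of the
  end points remain.\<close>

lemma mat_power_markov_nth:
  "mat_power (markov_mat x \<epsilon>) t $ i $ j
    = sqrt (node_degree x \<epsilon> j) / sqrt (node_degree x \<epsilon> i) * mat_power (sym_markov_mat x \<epsilon>) t $ i $ j"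
proof (induction t arbitrary: i)
  case 0
  then show ?case by (auto simp: mat_power_def mat_def node_degree_neq_0)
next
  case (Suc t)
  have step: "mat_power A (Suc t) $ i $ j = (\<Sum>l\<in>UNIV. A $ i $ l * mat_power A t $ l $ j)"
    for A :: "real^'a^'a"
    by (simp add: mat_power_def matrix_matrix_mult_def)
  have *: "1 / node_degree x \<epsilon> i = 1 / sqrt (node_degree x \<epsilon> i) / sqrt (node_degree x \<epsilon> i)"
    using node_degree_pos[of x \<epsilon> i] by simp
  have "markov_mat x \<epsilon> $ i $ l * mat_power (markov_mat x \<epsilon>) t $ l $ j =
    sqrt (node_degree x \<epsilon> j) / sqrt (node_degree x \<epsilon> i) *
    (sym_markov_mat x \<epsilon> $ i $ l * mat_power (sym_markov_mat x \<epsilon>) t $ l $ j)" for l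
    using node_degree_pos[of x \<epsilon> i] node_degree_pos[of x \<epsilon> l]
    by (simp add: Suc.IH markov_mat_nth sym_markov_mat_nth field_simps)
  then show ?case unfolding step by (simp add: sum_distrib_left)
qed

section \<open>Spectrum of the random walk\<close>

lemma mat_power_eigenvector:
  assumes "A *v f = c *\<^sub>R f"
  shows "mat_power A t *v f = c ^ t *\<^sub>R f"
proof (induction t)
  case 0
  then show ?case by (simp add: mat_power_def)
next
  case (Suc t)
  have "mat_power A (Suc t) *v f = A *v (mat_power A t *v f)"
    by (simp add: mat_power_def matrix_vector_mul_assoc)
  then show ?case by (simp add: Suc.IH assms matrix_vector_mult_scaleR mult.commute)
qed

text \<open>The residual is orthogonal to every basis vector, hence to their span, which is the
  whole space, hence to itself.\<close>

lemma orthonormal_basis_expansion: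
  fixes v :: "nat \<Rightarrow> real^'n::finite"
  assumes "is_orthonormal_basis v"
  shows "y = (\<Sum>j<CARD('n). (y \<bullet> v j) *\<^sub>R v j)"
proof -
  let ?z = "y - (\<Sum>j<CARD('n). (y \<bullet> v j) *\<^sub>R v j)"
  have "orthogonal ?z b" if b: "b \<in> v ` {..<CARD('n)}" for b
  proof -
    obtain i where i: "b = v i" "i < CARD('n)" using b by auto
    have "(\<Sum>j<CARD('n). (y \<bullet> v j) *\<^sub>R v j) \<bullet> v i
        = (\<Sum>j<CARD('n). if j = i then y \<bullet> v j else 0)"
      using assms i(2) unfolding inner_sum_left
      by (intro sum.cong) (auto simp: is_orthonormal_basis_def)
    then show ?thesis using i by (simp add: orthogonal_def inner_diff_left)
  qed
  then have "orthogonal ?z ?z"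
    using assms orthogonal_to_span[of ?z "v ` {..<CARD('n)}" ?z]
    by (simp add: is_orthonormal_basis_def)
  then show ?thesis by (simp add: orthogonal_def)
qed

text \<open>The eigenvalue is the Rayleigh quotient at the unit vector \<open>v j\<close>, which
  equals the kernel's quadratic form at \<open>v j\<close> divided entrywise by the root
  degrees.\<close>

lemma markov_spectrum_nonneg:
  fixes v :: "nat \<Rightarrow> real^'n::finite"
  assumes "markov_spectrum x \<epsilon> lam v" "\<epsilon> > 0" "j < CARD('n)"
  shows "lam j \<ge> 0"
proof -
  have "v j \<bullet> v j = 1" and eig: "sym_markov_mat x \<epsilon> *v v j = lam j *\<^sub>R v j"
    using assms by (auto simp: markov_spectrum_def is_orthonormal_basis_def)
  then have "lam j = v j \<bullet> (sym_markov_mat x \<epsilon> *v v j)" by simp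
  also have "\<dots> = (\<Sum>a\<in>UNIV. \<Sum>b\<in>UNIV. (v j $ a / sqrt (node_degree x \<epsilon> a)) *
      (v j $ b / sqrt (node_degree x \<epsilon> b)) * kernel_mat x \<epsilon> $ a $ b)"
    by (simp add: inner_vec_def matrix_vector_mult_def sym_markov_mat_nth sum_distrib_left mult_ac)
  also have "\<dots> \<ge> 0" by (rule kernel_mat_psd[OF assms(2)])
  finally show ?thesis .
qed

text \<open>The positive function \<open>v\<^sub>0 / \<surd>D\<close> is an eigenfunction of the averaging operator \<open>M\<close>: the
  minimum principle bounds the eigenvalue below by 1, and then the maximum principle makes the
  function constant.\<close>
lemma markov_spectrum_top:
  fixes v :: "nat \<Rightarrow> real^'n::finite"
  assumes "markov_spectrum x \<epsilon> lam v"
  shows "lam 0 = 1" "v 0 $ i = sqrt (node_degree x \<epsilon> i) / sqrt (total_degree x \<epsilon>)"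
proof -
  let ?D = "node_degree x \<epsilon>" and ?L = "kernel_mat x \<epsilon>"
  define u where "u i = v 0 $ i / sqrt (?D i)" for i
  have pos: "v 0 $ i > 0" for i using assms by (simp add: markov_spectrum_def)
  have upos: "u i > 0" for i using pos[of i] node_degree_pos[of x \<epsilon> i] by (simp add: u_def)
  have eig: "sym_markov_mat x \<epsilon> *v v 0 = lam 0 *\<^sub>R v 0" and nv: "v 0 \<bullet> v 0 = 1"
    using assms by (auto simp: markov_spectrum_def is_orthonormal_basis_def)
  \<comment> \<open>The eigenvalue equation for \<open>u\<close> with the degree cleared from the
    denominator.\<close>
  have av: "(\<Sum>j\<in>UNIV. ?L $ i $ j * u j) = lam 0 * ?D i * u i" for i
  proof -
    have "(\<Sum>j\<in>UNIV. ?L $ i $ j * u j) = sqrt (?D i) * (sym_markov_mat x \<epsilon> *v v 0) $ i"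
      using node_degree_pos[of x \<epsilon> i]
      by (simp add: matrix_vector_mult_def sym_markov_mat_nth u_def sum_distrib_left field_simps)
    also have "\<dots> = lam 0 * (sqrt (?D i) * sqrt (?D i)) * u i"
      using node_degree_neq_0[of x \<epsilon> i] unfolding eig u_def vector_scaleR_component
      by (simp del: real_sqrt_mult_self)
    finally show ?thesis using node_degree_pos[of x \<epsilon> i] by simp
  qed
  define lo where "lo = Min (range u)"
  define hi where "hi = Max (range u)"
  have lo: "lo \<le> u j" and hi: "u j \<le> hi" for j unfolding lo_def hi_def by auto
  obtain a where a: "u a = lo" using Min_in[of "range u"] unfolding lo_def by (metis UNIV_not_empty empty_is_image finite finite_imageI rangeE)
  obtain b where b: "u b = hi" using Max_in[of "range u"] unfolding hi_def by (metis UNIV_not_empty empty_is_image finite finite_imageI rangeE)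
  have "?D a * lo \<le> (\<Sum>j\<in>UNIV. ?L $ a $ j * u j)"
    unfolding node_degree_def sum_distrib_right
    by (intro sum_mono mult_left_mono lo less_imp_le[OF kernel_mat_pos])
  then have "?D a * lo \<le> lam 0 * ?D a * lo" by (simp add: av a)
  then have ge1: "lam 0 \<ge> 1"
    using node_degree_pos[of x \<epsilon> a] upos[of a] a by (simp add: mult.assoc)
  have "(\<Sum>j\<in>UNIV. ?L $ b $ j * u j) \<le> ?D b * hi"
    unfolding node_degree_def sum_distrib_right
    by (intro sum_mono mult_left_mono hi less_imp_le[OF kernel_mat_pos])
  then have "lam 0 * ?D b * hi \<le> ?D b * hi" by (simp add: av b)
  then have "lam 0 \<le> 1"
    using node_degree_pos[of x \<epsilon> b] upos[of b] b by (simp add: mult.assoc)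
  with ge1 show l0: "lam 0 = 1" by simp
  \<comment> \<open>A sum of nonnegative gaps \<open>hi - u j\<close> with strictly positive weights
    vanishes, so every gap vanishes.\<close>
  have "(\<Sum>j\<in>UNIV. ?L $ b $ j * (hi - u j)) = 0"
    using av[of b] l0 b
    by (simp add: right_diff_distrib sum_subtractf node_degree_def sum_distrib_right)
  then have "?L $ b $ j * (hi - u j) = 0" for j
    using hi kernel_mat_pos[of x \<epsilon> b] by (subst (asm) sum_nonneg_eq_0_iff) (auto simp: less_imp_le)
  then have const: "u j = hi" for j
    using kernel_mat_pos[of x \<epsilon> b j] by (metis eq_iff_diff_eq_0 less_irrefl mult_eq_0_iff)
  then have v0: "v 0 $ j = hi * sqrt (?D j)" for j
    using node_degree_neq_0[of x \<epsilon> j] unfolding u_def by (metis nonzero_divide_eq_eq real_sqrt_eq_zero_cancel_iff)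
  \<comment> \<open>The unit norm of \<open>v 0\<close> determines the square of the constant
    \<open>hi\<close>; positivity selects the root.\<close>
  have "1 = hi\<^sup>2 * total_degree x \<epsilon>"
    using nv node_degree_pos[of x \<epsilon>] 
    by (simp add: inner_vec_def v0 total_degree_def sum_distrib_left power2_eq_square less_imp_le
        mult.assoc mult.left_commute)
  moreover have "hi > 0" using upos[of b] b by simp
  ultimately have "hi * sqrt (total_degree x \<epsilon>) = 1"
    by (metis real_sqrt_mult real_sqrt_one real_sqrt_unique less_imp_le)
  then have "hi = 1 / sqrt (total_degree x \<epsilon>)"
    using total_degree_pos[of x \<epsilon>] by (simp add: field_simps)
  then show "v 0 $ i = sqrt (?D i) / sqrt (total_degree x \<epsilon>)" by (simp add: v0)
qed

section \<open>Eigenvector entries and the error as a Frobenius distance\<close>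

lemma left_eigvec_nth:
  "left_eigvec x \<epsilon> v j $ i = sqrt (node_degree x \<epsilon> i) / sqrt (total_degree x \<epsilon>) * v j $ i"
  by (simp add: left_eigvec_def sqrt_degree_mat_def diag_mult_vec_nth)

lemma right_eigvec_nth:
  "right_eigvec x \<epsilon> v j $ i = sqrt (total_degree x \<epsilon>) / sqrt (node_degree x \<epsilon> i) * v j $ i"
  by (simp add: right_eigvec_def sqrt_degree_mat_def matrix_inv_diag node_degree_neq_0
      diag_mult_vec_nth)

lemma left_eigvec_0_nth:
  assumes "markov_spectrum x \<epsilon> lam v"
  shows "left_eigvec x \<epsilon> v 0 $ i = node_degree x \<epsilon> i / total_degree x \<epsilon>"
  using node_degree_pos[of x \<epsilon> i] total_degree_pos[of x \<epsilon>]
  by (simp add: left_eigvec_nth markov_spectrum_top(2)[OF assms])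

text \<open>The inner product of row \<open>i\<close> with \<open>v j\<close> is entry
  \<open>i\<close> of the power applied to \<open>v j\<close>, which gives the Fourier coefficients.
  The term of index 0 is split off because every approximation contains \<open>\<phi>0\<close> with
  a fixed coefficient; \<open>lam 0 = 1\<close> frees it of \<open>t\<close>.\<close>

lemma sym_markov_power_row:
  fixes v :: "nat \<Rightarrow> real^'n::finite"
  assumes "markov_spectrum x \<epsilon> lam v"
  shows "mat_power (sym_markov_mat x \<epsilon>) t $ i
    = v 0 $ i *\<^sub>R v 0 + (\<Sum>j=1..CARD('n) - 1. (lam j ^ t * v j $ i) *\<^sub>R v j)"
proof -
  let ?r = "mat_power (sym_markov_mat x \<epsilon>) t $ i"
  have onb: "is_orthonormal_basis v"
    and eig: "\<And>j. j < CARD('n) \<Longrightarrow> sym_markov_mat x \<epsilon> *v v j = lam j *\<^sub>R v j"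
    using assms by (auto simp: markov_spectrum_def)
  have "?r \<bullet> v j = lam j ^ t * v j $ i" if "j < CARD('n)" for j
  proof -
    have "?r \<bullet> v j = (mat_power (sym_markov_mat x \<epsilon>) t *v v j) $ i"
      by (simp add: inner_vec_def matrix_vector_mult_def)
    then show ?thesis by (simp add: mat_power_eigenvector[OF eig[OF that]])
  qed
  then have "?r = (\<Sum>j<CARD('n). (lam j ^ t * v j $ i) *\<^sub>R v j)"
    by (subst orthonormal_basis_expansion[OF onb, of ?r]) (auto intro!: sum.cong)
  also have "{..<CARD('n)} = insert 0 {1..CARD('n) - 1}" using zero_less_card_finite by force
  finally show ?thesis by (simp add: markov_spectrum_top(1)[OF assms])
qed

text \<open>The weights of the error undo the similarity between the two matrices, and the
  stationary terms cancel. What is subtracted is, row by row, a combination of \<open>k\<close>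
  vectors that do not depend on \<open>i\<close>.\<close>

lemma mean_sq_error_eq_frobenius:
  fixes v :: "nat \<Rightarrow> real^'n::finite" and a :: "nat \<Rightarrow> 'n \<Rightarrow> nat \<Rightarrow> real"
  assumes "markov_spectrum x \<epsilon> lam v"
  shows "mean_sq_error (left_eigvec x \<epsilon> v 0) (transition_prob x \<epsilon> t)
      (kdim_approx (left_eigvec x \<epsilon> v 0) k t a w)
    = (\<Sum>i\<in>UNIV. (norm ((\<Sum>j=1..CARD('n) - 1. (lam j ^ t * v j $ i) *\<^sub>R v j)
        - (\<Sum>j=1..k. (sqrt (node_degree x \<epsilon> i) * a j i t) *\<^sub>R
            (\<chi> y. w j $ y / sqrt (node_degree x \<epsilon> y)))))\<^sup>2)"
    (is "_ = (\<Sum>i\<in>UNIV. (norm (?b i - ?c i))\<^sup>2)")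
proof -
  let ?D = "node_degree x \<epsilon>" and ?S = "total_degree x \<epsilon>"
  have entry: "?D i / ?S * ((transition_prob x \<epsilon> t i
        - kdim_approx (left_eigvec x \<epsilon> v 0) k t a w i) $ y)\<^sup>2 * (1 / (?D y / ?S))
      = ((?b i - ?c i) $ y)\<^sup>2" for i y
  proof -
    \<comment> \<open>Naming the root degrees turns the identities below into rational ones in
      \<open>p\<close>, \<open>q\<close> and the total degree.\<close>
    define p where "p = sqrt (?D i)"
    define q where "q = sqrt (?D y)"
    have pq: "p > 0" "q > 0" "?D i = p * p" "?D y = q * q" "?S > 0"
      using node_degree_pos[of x \<epsilon> i] node_degree_pos[of x \<epsilon> y] total_degree_pos[of x \<epsilon>]
      by (simp_all add: p_def q_def)
    define g where "g = (\<Sum>j=1..k. a j i t * w j $ y)"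
    have c: "?c i $ y = p / q * g"
      by (simp add: g_def p_def q_def sum_distrib_left mult.assoc)
    \<comment> \<open>The summand \<open>p * q / ?S\<close> is the product of entries
      \<open>i\<close> and \<open>y\<close> of \<open>v 0\<close>; multiplied by
      \<open>q / p\<close> it becomes the stationary density at \<open>y\<close>, the first summand
      in \<open>K\<close>.\<close>
    have T: "transition_prob x \<epsilon> t i $ y = q / p * (p * q / ?S + ?b i $ y)"
      using pq(5) by (simp add: transition_prob_def mat_power_markov_nth
          sym_markov_power_row[OF assms] markov_spectrum_top(2)[OF assms] p_def q_def)
    have K: "kdim_approx (left_eigvec x \<epsilon> v 0) k t a w i $ y = q * q / ?S + g"
      using pq(4) by (simp add: kdim_approx_def left_eigvec_0_nth[OF assms] g_def)
    have "(transition_prob x \<epsilon> t i - kdim_approx (left_eigvec x \<epsilon> v 0) k t a w i) $ y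
        = q / p * (?b i - ?c i) $ y"
      unfolding vector_minus_component T c K using pq by (simp add: field_simps)
    moreover have "p * p / ?S * (q / p * z)\<^sup>2 * (1 / (q * q / ?S)) = z\<^sup>2" for z
      using pq by (simp add: power2_eq_square field_simps)
    ultimately show ?thesis by (simp only: pq(3,4))
  qed
  have "mean_sq_error (left_eigvec x \<epsilon> v 0) (transition_prob x \<epsilon> t)
      (kdim_approx (left_eigvec x \<epsilon> v 0) k t a w)
    = (\<Sum>i\<in>UNIV. \<Sum>y\<in>UNIV. ?D i / ?S * ((transition_prob x \<epsilon> t i
        - kdim_approx (left_eigvec x \<epsilon> v 0) k t a w i) $ y)\<^sup>2 * (1 / (?D y / ?S)))"
    unfolding mean_sq_error_def weighted_norm_sq_def
    by (simp add: left_eigvec_0_nth[OF assms] sum_distrib_left mult.assoc)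
  also have "\<dots> = (\<Sum>i\<in>UNIV. \<Sum>y\<in>UNIV. ((?b i - ?c i) $ y)\<^sup>2)" by (simp only: entry)
  also have "\<dots> = (\<Sum>i\<in>UNIV. (norm (?b i - ?c i))\<^sup>2)"
    by (simp only: power2_norm_eq_inner inner_vec_def) (simp add: power2_eq_square)
  finally show ?thesis .
qed

section \<open>Optimality of the truncated expansion\<close>

text \<open>The first conjunct minimizes over pairs of coefficients and functions, the second over
  the approximations themselves. \<open>is_arg_min\<close> claims attainment, not uniqueness:
  scaling \<open>w j\<close> against \<open>a j\<close> gives the same approximation.\<close>

theorem mainTheorem2:
  fixes x :: "'n::finite \<Rightarrow> real^'p::finite"
    and \<epsilon> :: real
    and lam :: "nat \<Rightarrow> real"
    and v :: "nat \<Rightarrow> real^'n"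
    and t k :: nat
  defines "\<phi> \<equiv> left_eigvec x \<epsilon> v"
    and "\<psi> \<equiv> right_eigvec x \<epsilon> v"
  assumes "\<epsilon> > 0"
    and "graph_connected x \<epsilon>"
    and "markov_spectrum x \<epsilon> lam v"
    and "1 \<le> k" and "k \<le> CARD('n) - 1"
  shows
    "is_arg_min
       (\<lambda>(a, w). mean_sq_error (\<phi> 0) (transition_prob x \<epsilon> t) (kdim_approx (\<phi> 0) k t a w))
       (\<lambda>_. True)
       (\<lambda>j i s. lam j ^ s * \<psi> j $ i, \<phi>)
     \<and> is_arg_min
       (\<lambda>q. mean_sq_error (\<phi> 0) (transition_prob x \<epsilon> t) q)
       (\<lambda>q. \<exists>a w. q = kdim_approx (\<phi> 0) k t a w)
       (\<lambda>i. \<chi> y. \<phi> 0 $ y + (\<Sum>j = 1..k. lam j ^ t * \<psi> j $ i * \<phi> j $ y))"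
proof -
  let ?N = "CARD('n) - 1" and ?D = "node_degree x \<epsilon>"
  let ?err = "\<lambda>a w. mean_sq_error (\<phi> 0) (transition_prob x \<epsilon> t) (kdim_approx (\<phi> 0) k t a w)"
  let ?a = "\<lambda>j i s. lam j ^ s * \<psi> j $ i"
  note spec = \<open>markov_spectrum x \<epsilon> lam v\<close>
  have less: "j < CARD('n)" if "j \<in> {1..?N}" for j
    using that zero_less_card_finite[where 'a='n] by auto
  have on: "v i \<bullet> v j = (if i = j then 1 else 0)" if "i \<in> {1..?N}" "j \<in> {1..?N}" for i j
    using spec less[OF that(1)] less[OF that(2)]
    by (simp add: markov_spectrum_def is_orthonormal_basis_def)
  \<comment> \<open>Nonnegativity of the eigenvalues lets their decreasing order survive taking
    powers.\<close>
  have dec: "(lam l ^ t)\<^sup>2 \<le> (lam j ^ t)\<^sup>2" if "1 \<le> j" "j \<le> l" "l \<le> ?N" for j l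
  proof -
    have l: "l < CARD('n)" using less that by auto
    then have "0 \<le> lam l" using markov_spectrum_nonneg[OF spec \<open>\<epsilon> > 0\<close>] by simp
    moreover have "lam l \<le> lam j" using spec that l by (simp add: markov_spectrum_def)
    ultimately show ?thesis by (intro power_mono) auto
  qed
  have lower: "(\<Sum>j=k+1..?N. (lam j ^ t)\<^sup>2) \<le> ?err a w" for a w
  proof -
    \<comment> \<open>The \<open>k\<close> rescaled functions span the subspace that contains all
      rows of the approximating matrix.\<close>
    define z where "z j = (\<chi> y. w j $ y / sqrt (?D y))" for j
    have "dim (span (z ` {1..k})) \<le> k"
      using dim_le_card'[of "z ` {1..k}"] card_image_le[of "{1..k}" z] by simp
    moreover have "(\<Sum>j=1..k. (sqrt (?D i) * a j i t) *\<^sub>R z j) \<in> span (z ` {1..k})" for i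
      by (intro span_sum span_scale span_base) auto
    ultimately show ?thesis
      unfolding \<phi>_def mean_sq_error_eq_frobenius[OF spec] z_def[symmetric]
      using on dec assms(6,7)
      by (intro eckart_young_frobenius[where W = "span (z ` {1..k})"]) auto
  qed
  have attained: "?err ?a \<phi> = (\<Sum>j=k+1..?N. (lam j ^ t)\<^sup>2)"
  proof -
    \<comment> \<open>The degree factors in \<open>\<phi>\<close> and \<open>\<psi>\<close> cancel
      against the rescaling, so the candidate becomes the first \<open>k\<close> terms of the
      spectral expansion and its error the tail.\<close>
    have "(\<chi> y. \<phi> j $ y / sqrt (?D y)) = (1 / sqrt (total_degree x \<epsilon>)) *\<^sub>R v j" for j
      by (simp add: vec_eq_iff \<phi>_def left_eigvec_nth node_degree_neq_0)
    then have c: "(sqrt (?D i) * ?a j i t) *\<^sub>R (\<chi> y. \<phi> j $ y / sqrt (?D y))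
        = (lam j ^ t * v j $ i) *\<^sub>R v j" for i j
      using total_degree_pos[of x \<epsilon>]
      by (simp add: \<psi>_def right_eigvec_nth node_degree_neq_0)
    have eq: "{1..?N} = {1..k} \<union> {k+1..?N}" using assms(6,7) by auto
    have "(\<Sum>j=1..?N. f j) - (\<Sum>j=1..k. f j) = (\<Sum>j=k+1..?N. f j)" for f :: "nat \<Rightarrow> real^'n"
      unfolding eq by (subst sum.union_disjoint) auto
    then have "?err ?a \<phi> = (\<Sum>i\<in>UNIV. (norm (\<Sum>j=k+1..?N. (lam j ^ t * v j $ i) *\<^sub>R v j))\<^sup>2)"
      using c mean_sq_error_eq_frobenius[OF spec, of t k ?a \<phi>] by (simp add: \<phi>_def)
    also have "\<dots> = (\<Sum>j=k+1..?N. (lam j ^ t)\<^sup>2)"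
      using on assms(6) by (intro frobenius_norm_orthonormal_sum) (auto simp: norm_eq_1)
    finally show ?thesis .
  qed
  have min: "?err ?a \<phi> \<le> ?err a w" for a w unfolding attained by (rule lower)
  \<comment> \<open>The truncated sum is the approximation of the candidate pair, so
    \<open>min\<close> settles both conjuncts.\<close>
  have trunc: "(\<lambda>i. \<chi> y. \<phi> 0 $ y + (\<Sum>j = 1..k. lam j ^ t * \<psi> j $ i * \<phi> j $ y))
      = kdim_approx (\<phi> 0) k t ?a \<phi>"
    by (simp add: fun_eq_iff vec_eq_iff kdim_approx_def)
  show ?thesis unfolding trunc is_arg_min_def using min by (auto simp: not_less)
qed

end
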